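(* Let $X,Y$ be non-commuting indeterminates and $C=XYX^{-1}Y^{-1}$. Let $(R_n)_{n\in\mathbb Z}$ satisfy $$R_{2n}CR_{2n-2}=1+R_{2n-1},\qquad R_{2n+1}CR_{2n-1}=1+R_{2n}^4\qquad(n\in\mathbb Z),$$ with $R_1=YXY^{-1}$ and $R_2=Y$. Then for all $n\ge0$, $R_n$ is a Laurent polynomial in $X,Y$ with only non-negative integer coefficients.
   Context: Work in the free skew field (non-commutative rational functions) over $\mathbb C$ generated by $X,Y$. A Laurent polynomial in $X,Y$ is a $\mathbb Z$-linear combination of words in $X^{\pm1},Y^{\pm1}$. *)

theory Defs
  imports Main
begin

(* A letter of the free group on X, Y: (gen, sign) with gen = True for X, False for Y,
   sign = True for exponent +1, False for exponent -1. *)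
type_synonym letter = "bool \<times> bool"
type_synonym word = "letter list"

definition ev_letter :: "'a::division_ring \<Rightarrow> 'a \<Rightarrow> letter \<Rightarrow> 'a" where
  "ev_letter x y l = (let g = (if fst l then x else y) in if snd l then g else inverse g)"

definition ev_word :: "'a::division_ring \<Rightarrow> 'a \<Rightarrow> word \<Rightarrow> 'a" where
  "ev_word x y w = prod_list (map (ev_letter x y) w)"

definition reduced_word :: "word \<Rightarrow> bool" where
  "reduced_word w \<longleftrightarrow> (\<forall>i. Suc i < length w \<longrightarrow>
      \<not> (fst (w ! i) = fst (w ! Suc i) \<and> snd (w ! i) \<noteq> snd (w ! Suc i)))"

definition ev_laurent :: "'a::division_ring \<Rightarrow> 'a \<Rightarrow> (word \<Rightarrow> int) \<Rightarrow> 'a" where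
  "ev_laurent x y f = (\<Sum>w\<in>{w. f w \<noteq> 0}. of_int (f w) * ev_word x y w)"

(* x, y are "free" in the division ring: the integral group ring of the free group
   on X, Y embeds via evaluation (distinct reduced words, i.e. distinct free-group
   elements, are linearly independent over Z).  This holds for the generators of the
   free skew field. *)
definition free_pair :: "'a::division_ring \<Rightarrow> 'a \<Rightarrow> bool" where
  "free_pair x y \<longleftrightarrow> (\<forall>f :: word \<Rightarrow> int. finite {w. f w \<noteq> 0} \<longrightarrow>
       (\<forall>w. f w \<noteq> 0 \<longrightarrow> reduced_word w) \<longrightarrow> ev_laurent x y f = 0 \<longrightarrow> (\<forall>w. f w = 0))"

definition nonneg_laurent :: "'a::division_ring \<Rightarrow> 'a \<Rightarrow> 'a \<Rightarrow> bool" where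
  "nonneg_laurent x y r \<longleftrightarrow> (\<exists>f :: word \<Rightarrow> nat. finite {w. f w \<noteq> 0} \<and>
       r = (\<Sum>w\<in>{w. f w \<noteq> 0}. of_nat (f w) * ev_word x y w))"

end

theory Submission
  imports Defs
begin

text \<open>
  Write \<open>a\<^sub>k = R\<^bsub>2k\<^esub>\<close> and \<open>b\<^sub>k = R\<^bsub>2k+1\<^esub>\<close>. Consecutive terms quasi-commute, and then
  \<open>H = a\<^bsub>k+1\<^esub> C a\<^bsub>k-1\<^esub> - a\<^sub>k\<^sup>2\<close> does not depend on \<open>k\<close> and satisfies \<open>H a\<^sub>k = a\<^bsub>k+1\<^esub> + C a\<^bsub>k-1\<^esub>\<close>.
  Explicitly \<open>H = g + g' + u\<close> with positive terms such that \<open>g u = C\<close>, so the differences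
  \<open>d\<^sub>k = a\<^bsub>k+1\<^esub> - u a\<^sub>k\<close> satisfy \<open>d\<^sub>k = (g + g') d\<^bsub>k-1\<^esub> + g' u a\<^bsub>k-1\<^esub>\<close>: the system is subtraction-free.
  For the odd terms \<open>b\<^sub>k = a\<^bsub>k+1\<^esub> C a\<^sub>k - 1\<close>, the \<open>1\<close> is cancelled by the product of two extreme
  terms, \<open>g\<^bsup>k-1\<^esup> X Y\<^bsup>-1\<^esup> X\<^bsup>-1\<^esup>\<close> of \<open>d\<^sub>k\<close> and \<open>u\<^bsup>k-1\<^esup> Y\<close> of \<open>a\<^sub>k\<close>. Freeness is only needed to see that no
  \<open>R\<^sub>n\<close> vanishes, so that factors can be cancelled.
\<close>

section \<open>Sums of words with multiplicities\<close>

lemma sum_list_eq_sum_count_list: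
  fixes g :: "'b \<Rightarrow> 'a::semiring_1"
  shows "(\<Sum>w\<leftarrow>ws. g w) = (\<Sum>w\<in>{w. count_list ws w \<noteq> 0}. of_nat (count_list ws w) * g w)"
proof -
  \<comment> \<open>An arbitrary finite superset \<open>A\<close> keeps the index set fixed during
    the induction on \<open>ws\<close>.\<close>
  have *: "(\<Sum>w\<leftarrow>ws. g w) = (\<Sum>w\<in>A. of_nat (count_list ws w) * g w)"
    if "finite A" "set ws \<subseteq> A" for A
    using that(2)
  proof (induction ws)
    case (Cons v vs)
    have "(\<Sum>w\<in>A. of_nat (count_list (v # vs) w) * g w)
        = (\<Sum>w\<in>A. (if w = v then g w else 0) + of_nat (count_list vs w) * g w)"
      by (intro sum.cong) (auto simp: algebra_simps)
    also have "\<dots> = g v + (\<Sum>w\<in>A. of_nat (count_list vs w) * g w)"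
      using Cons.prems that(1) by (simp add: sum.distrib)
    finally show ?case
      using Cons by simp
  qed simp
  have "{w. count_list ws w \<noteq> 0} = set ws"
    by (auto simp: count_list_0_iff)
  then show ?thesis
    using *[of "set ws"] by simp
qed

lemma finite_count_list_support: "finite {w. count_list ws w \<noteq> 0}"
  by (rule finite_subset[of _ "set ws"]) (auto simp: count_list_0_iff)

text \<open>Positivity is stored as a list whose repetitions are the coefficients, so that sums and
  products become operations on lists. The words may be unreduced.\<close>

definition word_sum :: "'a::division_ring \<Rightarrow> 'a \<Rightarrow> 'a \<Rightarrow> bool" where
  "word_sum x y r \<longleftrightarrow> (\<exists>ws. r = (\<Sum>w\<leftarrow>ws. ev_word x y w))"

lemma ev_word_append: "ev_word x y (v @ w) = ev_word x y v * ev_word x y w"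
  by (simp add: ev_word_def)

lemma word_sum_ev_word: "word_sum x y (ev_word x y w)"
  unfolding word_sum_def by (rule exI[of _ "[w]"]) simp

lemma word_sum_zero: "word_sum x y 0"
  unfolding word_sum_def by (rule exI[of _ "[]"]) simp

lemma word_sum_one: "word_sum x y 1"
  using word_sum_ev_word[of x y "[]"] by (simp add: ev_word_def)

lemma word_sum_generators:
  "word_sum x y x" "word_sum x y y" "word_sum x y (inverse x)" "word_sum x y (inverse y)"
  using word_sum_ev_word[of x y "[(True, True)]"] word_sum_ev_word[of x y "[(False, True)]"]
    word_sum_ev_word[of x y "[(True, False)]"] word_sum_ev_word[of x y "[(False, False)]"]
  by (simp_all add: ev_word_def ev_letter_def)

lemma word_sum_add:
  assumes "word_sum x y r" "word_sum x y s"
  shows "word_sum x y (r + s)"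
proof -
  obtain us vs where "r = (\<Sum>w\<leftarrow>us. ev_word x y w)" "s = (\<Sum>w\<leftarrow>vs. ev_word x y w)"
    using assms unfolding word_sum_def by auto
  then have "r + s = (\<Sum>w\<leftarrow>us @ vs. ev_word x y w)"
    by simp
  then show ?thesis
    unfolding word_sum_def by blast
qed

lemma word_sum_mult:
  assumes "word_sum x y r" "word_sum x y s"
  shows "word_sum x y (r * s)"
proof -
  obtain us vs where r: "r = (\<Sum>w\<leftarrow>us. ev_word x y w)" and s: "s = (\<Sum>w\<leftarrow>vs. ev_word x y w)"
    using assms unfolding word_sum_def by auto
  have shift: "word_sum x y (ev_word x y u * s)" for u
  proof -
    have "ev_word x y u * s = (\<Sum>w\<leftarrow>map ((@) u) vs. ev_word x y w)"
      unfolding s by (induction vs) (simp_all add: ev_word_append algebra_simps)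
    then show ?thesis
      unfolding word_sum_def by blast
  qed
  show ?thesis
    unfolding r by (induction us) (simp_all add: word_sum_zero word_sum_add shift distrib_right)
qed

lemma word_sum_power: "word_sum x y r \<Longrightarrow> word_sum x y (r ^ n)"
  by (induction n) (simp_all add: word_sum_one word_sum_mult)

lemmas word_sum_intros =
  word_sum_one word_sum_generators word_sum_add word_sum_mult word_sum_power

lemma word_sum_imp_nonneg_laurent:
  assumes "word_sum x y r"
  shows "nonneg_laurent x y r"
proof -
  obtain ws where "r = (\<Sum>w\<leftarrow>ws. ev_word x y w)"
    using assms unfolding word_sum_def by auto
  then show ?thesis
    unfolding nonneg_laurent_def
    by (intro exI[of _ "count_list ws"] conjI)
      (simp_all only: finite_count_list_support sum_list_eq_sum_count_list)
qed

section \<open>Reduced words and nonvanishing from freeness\<close>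

lemma reduced_word_Cons_Cons:
  "reduced_word (l # m # w) \<longleftrightarrow>
    \<not> (fst l = fst m \<and> snd l \<noteq> snd m) \<and> reduced_word (m # w)" (is "?L \<longleftrightarrow> ?R")
proof
  assume ?L
  then show ?R
    unfolding reduced_word_def
    by (metis Suc_less_eq length_Cons nth_Cons_0 nth_Cons_Suc zero_less_Suc)
next
  assume R: ?R
  show ?L
    unfolding reduced_word_def
  proof (intro allI impI)
    fix i
    assume "Suc i < length (l # m # w)"
    with R show "\<not> (fst ((l # m # w) ! i) = fst ((l # m # w) ! Suc i) \<and>
        snd ((l # m # w) ! i) \<noteq> snd ((l # m # w) ! Suc i))"
      by (cases i) (auto simp: reduced_word_def)
  qed
qed

lemma reduced_word_trivial: "reduced_word []" "reduced_word [l]"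
  by (simp_all add: reduced_word_def)

text \<open>A letter put in front of a reduced word either keeps it reduced or cancels its head, and
  the tail is again reduced.\<close>

lemma ex_reduced_word:
  assumes "x \<noteq> 0" "y \<noteq> 0"
  shows "\<exists>v. reduced_word v \<and> ev_word x y v = ev_word x y w"
proof (induction w)
  case Nil
  then show ?case
    using reduced_word_trivial by blast
next
  case (Cons l w)
  then obtain v where v: "reduced_word v" "ev_word x y v = ev_word x y w"
    by blast
  have eq: "ev_word x y (l # v) = ev_word x y (l # w)"
    using v(2) by (simp add: ev_word_def)
  show ?case
  proof (cases "reduced_word (l # v)")
    case True
    with eq show ?thesis
      by blast
  next
    case False
    then obtain m u where u: "v = m # u" and "fst l = fst m" "snd l \<noteq> snd m"
      using v(1) by (cases v) (auto simp: reduced_word_trivial reduced_word_Cons_Cons)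
    then have "ev_letter x y l * ev_letter x y m = 1"
      using assms by (auto simp: ev_letter_def Let_def)
    then have "ev_word x y (l # v) = ev_word x y u"
      by (simp add: u ev_word_def flip: mult.assoc)
    moreover have "reduced_word u"
      using v(1) unfolding u
      by (cases u) (auto simp: reduced_word_trivial reduced_word_Cons_Cons)
    ultimately show ?thesis
      using eq by auto
  qed
qed

lemma free_pair_nonzero:
  assumes "free_pair x y"
  shows "x \<noteq> 0" "y \<noteq> 0"
proof -
  have "ev_word x y [l] \<noteq> 0" for l
  proof
    assume 0: "ev_word x y [l] = 0"
    define f :: "word \<Rightarrow> int" where "f w = (if w = [l] then 1 else 0)" for w
    have "{w. f w \<noteq> 0} = {[l]}"
      by (auto simp: f_def)
    then have "finite {w. f w \<noteq> 0}" "ev_laurent x y f = 0"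
      using 0 by (simp_all add: ev_laurent_def f_def)
    moreover have "\<forall>w. f w \<noteq> 0 \<longrightarrow> reduced_word w"
      using reduced_word_trivial(2)[of l] by (simp add: f_def)
    ultimately have "f [l] = 0"
      using assms unfolding free_pair_def by blast
    then show False
      by (simp add: f_def)
  qed
  from this[of "(True, True)"] this[of "(False, True)"] show "x \<noteq> 0" "y \<noteq> 0"
    by (auto simp: ev_word_def ev_letter_def)
qed

text \<open>After reducing the words of \<open>r\<close>, all coefficients are still nonnegative,
  and the empty word, which evaluates to 1, is counted at least once. Freeness therefore excludes
  the value 0.\<close>

lemma one_plus_word_sum_nonzero:
  assumes free: "free_pair x y" and "word_sum x y r"
  shows "1 + r \<noteq> 0"
proof
  assume 0: "1 + r = 0"
  obtain ws where ws: "r = (\<Sum>w\<leftarrow>ws. ev_word x y w)"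
    using assms unfolding word_sum_def by auto
  obtain red where red: "reduced_word (red w)" "ev_word x y (red w) = ev_word x y w" for w
    using ex_reduced_word[OF free_pair_nonzero[OF free]] by metis
  define vs where "vs = [] # map red ws"
  define f where "f w = int (count_list vs w)" for w
  have "reduced_word w" if "f w \<noteq> 0" for w
  proof -
    have "w \<in> set vs"
      using that count_list_0_iff[of vs w] by (auto simp: f_def)
    then show ?thesis
      using red(1) reduced_word_trivial(1) by (auto simp: vs_def)
  qed
  moreover have "finite {w. f w \<noteq> 0}"
    using finite_count_list_support[of vs] by (simp add: f_def)
  moreover have "ev_laurent x y f = 0"
  proof -
    have "ev_laurent x y f = (\<Sum>w\<leftarrow>vs. ev_word x y w)"
      unfolding sum_list_eq_sum_count_list ev_laurent_def f_def by simp
    also have "\<dots> = ev_word x y [] + r"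
      by (simp add: ws vs_def o_def red(2))
    also have "\<dots> = 0"
      using 0 by (simp add: ev_word_def)
    finally show ?thesis .
  qed
  ultimately have "f [] = 0"
    using free unfolding free_pair_def by blast
  then show False
    by (simp add: f_def vs_def)
qed

section \<open>Quasi-commutation and the conserved quantity\<close>

lemma inverse_mult_cancel:
  fixes z w :: "'a::division_ring"
  assumes "z \<noteq> 0"
  shows "z * (inverse z * w) = w" "inverse z * (z * w) = w"
  using assms by (simp_all flip: mult.assoc)

text \<open>Since \<open>q\<close> commutes with \<open>1 + q ^ k = r * c * p\<close>, moving it
  across and applying the known relation leaves a common right factor \<open>c * p\<close> to
  cancel. The exponents 1 and 4 serve the two recurrences.\<close>

lemma quasi_commute_step:
  fixes c p q r :: "'a::division_ring"
  assumes "p * q = q * c * p" and "r * c * p = 1 + q ^ k" and "c \<noteq> 0" "p \<noteq> 0"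
  shows "q * r = r * c * q"
proof -
  have "(q * r) * (c * p) = q * (1 + q ^ k)"
    by (simp add: mult.assoc flip: assms(2))
  also have "\<dots> = (1 + q ^ k) * q"
    by (simp add: algebra_simps power_commutes)
  also have "\<dots> = r * c * (p * q)"
    by (simp add: mult.assoc flip: assms(2))
  also have "\<dots> = (r * c * q) * (c * p)"
    unfolding assms(1) by (simp add: mult.assoc)
  finally show ?thesis
    using assms(3,4) by simp
qed

lemma reversed_product:
  fixes c p q b :: "'a::division_ring"
  assumes "q * c * p = 1 + b" and "p * b = b * c * p" and "p \<noteq> 0"
  shows "p * q * c = 1 + b * c"
proof -
  have "(p * q * c) * p = p * (q * c * p)"
    by (simp add: mult.assoc)
  also have "\<dots> = p + b * c * p"
    unfolding assms(1) using assms(2) by (simp add: distrib_left)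
  also have "\<dots> = (1 + b * c) * p"
    by (simp add: distrib_right)
  finally show ?thesis
    using assms(3) by simp
qed

text \<open>Here \<open>p\<close>, \<open>a\<close>, \<open>s\<close> are consecutive even-indexed
  terms, with \<open>b0\<close> and \<open>b1\<close> between them. Eliminating \<open>b0\<close>
  and \<open>b1\<close> from \<open>bb\<close> and cancelling a factor \<open>a\<close> gives the
  cubic identity \<open>cub\<close>, on which all three claims rest.\<close>

lemma conserved_local:
  fixes c p a s b0 b1 :: "'a::division_ring"
  assumes ap: "a * c * p = 1 + b0" and sa: "s * c * a = 1 + b1"
    and bb: "b1 * c * b0 = 1 + a ^ 4"
    and pb: "p * b0 = b0 * c * p" and ab: "a * b1 = b1 * c * a"
    and nz: "c \<noteq> 0" "p \<noteq> 0" "a \<noteq> 0"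
  shows "(s * c * p - a\<^sup>2) * a = s + c * p"
    and "a * (s * c * p - a\<^sup>2) = s * c + p"
    and "s * c * b0 = a ^ 3 + c * p"
proof -
  have pac: "p * a * c = 1 + b0 * c"
    using reversed_product[OF ap pb nz(2)] .
  have asc: "a * s * c = 1 + b1 * c"
    using reversed_product[OF sa ab nz(3)] .
  have b0: "b0 = p * a - inverse c"
  proof -
    have "b0 * c = (p * a - inverse c) * c"
      using pac nz by (simp add: algebra_simps)
    then show ?thesis
      using nz by simp
  qed
  \<comment> \<open>With \<open>b1\<close> from the forward product and \<open>b0\<close> from the
    reversed one, everything except the constant 1 has \<open>a\<close> as right factor, just as in
    \<open>1 + a ^ 4\<close>.\<close>
  have "b1 * c * b0 = (s * c * a - 1) * c * (p * a - inverse c)"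
    using b0 sa by simp
  also have "\<dots> = (s * c * a * c * p - c * p - s * c) * a + 1"
    using nz by (simp add: inverse_mult_cancel algebra_simps)
  finally have "(s * c * a * c * p - c * p - s * c) * a = a ^ 3 * a"
    using bb by (simp add: power_numeral_reduce mult.assoc)
  then have cub: "s * c * a * c * p - c * p - s * c = a ^ 3"
    using nz by simp
  then show "s * c * b0 = a ^ 3 + c * p"
    using ap by (simp add: algebra_simps)
  have pa: "p * a = a * c * p + inverse c - 1"
    using ap b0 by (simp add: algebra_simps)
  have as: "s * c * a = a * s + 1 - inverse c"
  proof -
    have "(a * s) * c = (inverse c + b1) * c"
      using asc nz by (simp add: algebra_simps)
    then have "a * s = inverse c + b1"
      using nz by simp
    then show ?thesis
      using sa by simp
  qed
  have "(s * c * p - a\<^sup>2) * a = s * c * (p * a) - a ^ 3"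
    by (simp add: algebra_simps power2_eq_square power3_eq_cube)
  also have "\<dots> = s + c * p"
    unfolding pa cub[symmetric] using nz by (simp add: inverse_mult_cancel algebra_simps)
  finally show "(s * c * p - a\<^sup>2) * a = s + c * p" .
  have "a * (s * c * p - a\<^sup>2) = a * s * c * p - a ^ 3"
    by (simp add: algebra_simps power2_eq_square power3_eq_cube)
  also have "\<dots> = a * s * c * p - ((s * c * a) * (c * p) - c * p - s * c)"
    unfolding cub[symmetric] by (simp add: mult.assoc)
  also have "\<dots> = s * c + p"
    unfolding as using nz by (simp add: inverse_mult_cancel algebra_simps)
  finally show "a * (s * c * p - a\<^sup>2) = s * c + p" .
qed

text \<open>For consecutive even-indexed terms \<open>p\<close>, \<open>a\<close>, \<open>s\<close>,
  \<open>t\<close>, the quantity formed at \<open>s\<close> equals \<open>h\<close>, because both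
  have the same product with \<open>b1\<close>, namely \<open>s ^ 2 + (c * a) ^ 2\<close>.\<close>

lemma conserved_step:
  fixes c h p a s t b0 b1 b2 :: "'a::division_ring"
  assumes ap: "a * c * p = 1 + b0" and sa: "s * c * a = 1 + b1" and ts: "t * c * s = 1 + b2"
    and bb1: "b1 * c * b0 = 1 + a ^ 4" and bb2: "b2 * c * b1 = 1 + s ^ 4"
    and ab: "a * b1 = b1 * c * a" and bs: "b1 * s = s * c * b1" and sb: "s * b2 = b2 * c * s"
    and nz: "c \<noteq> 0" "a \<noteq> 0" "s \<noteq> 0" "b1 \<noteq> 0"
    and h: "a * h = s * c + p"
  shows "h * s = t + c * a" and "s * h = t * c + a"
proof -
  have asc: "a * s * c = 1 + b1 * c"
    using reversed_product[OF sa ab nz(2)] .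
  have as: "a * s = inverse c + b1"
  proof -
    have "(a * s) * c = (inverse c + b1) * c"
      using asc nz by (simp add: algebra_simps)
    then show ?thesis
      using nz by simp
  qed
  \<comment> \<open>By \<open>ab\<close>, this is \<open>a\<close> conjugated by \<open>b1\<close>,
    so powers of \<open>a\<close> can be moved past \<open>b1\<close>.\<close>
  define a' where "a' = c * a"
  have pow: "a ^ k * b1 = b1 * a' ^ k" for k
  proof (induction k)
    case (Suc k)
    have "a ^ Suc k * b1 = a * (a ^ k * b1)"
      by (simp add: mult.assoc)
    also have "\<dots> = (a * b1) * a' ^ k"
      unfolding Suc by (simp add: mult.assoc)
    also have "\<dots> = b1 * a' ^ Suc k"
      unfolding ab a'_def by (simp add: mult.assoc)
    finally show ?case .
  qed simp
  have "b1 * (c * b0 * b1) = (1 + a ^ 4) * b1"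
    by (simp add: mult.assoc flip: bb1)
  also have "\<dots> = b1 * (1 + a' ^ 4)"
    by (simp add: algebra_simps pow)
  finally have cbb: "c * b0 * b1 = 1 + a' ^ 4"
    using nz by simp
  \<comment> \<open>The left factor \<open>c * a * c\<close> brings in
    \<open>a * c * p = 1 + b0\<close>, and cancelling it afterwards determines
    \<open>p * b1\<close>.\<close>
  have "(c * a * c) * (p * b1) = c * (a * c * p) * b1"
    by (simp add: mult.assoc)
  also have "\<dots> = c * b1 + c * b0 * b1"
    unfolding ap by (simp add: algebra_simps)
  also have "\<dots> = c * (a * s) + a' ^ 4"
    unfolding cbb as using nz by (simp add: inverse_mult_cancel algebra_simps)
  also have "\<dots> = (c * a * c) * (inverse c * s + a * a' ^ 2)"
    using nz by (simp add: inverse_mult_cancel algebra_simps a'_def power_numeral_reduce)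
  finally have pb: "p * b1 = inverse c * s + a * a' ^ 2"
    using nz by simp
  have "s * c * b1 = (a * s - inverse c) * s"
    using bs as by simp
  then have hb: "a * h * b1 = a * (s\<^sup>2 + a' ^ 2)"
    unfolding h using pb by (simp add: algebra_simps power2_eq_square)
  then have hb: "h * b1 = s\<^sup>2 + a' ^ 2"
    using nz by (simp add: mult.assoc)
  let ?g = "t * c * a - s\<^sup>2"
  have loc: "?g * s = t + c * a" "s * ?g = t * c + a"
    using conserved_local(1,2)[OF sa ts bb2 ab sb nz(1,2,3)] .
  have "t * c * b1 = s ^ 3 + c * a"
    using conserved_local(3)[OF sa ts bb2 ab sb nz(1,2,3)] .
  then have "t * c * b1 * c * a - s\<^sup>2 * b1 = (s ^ 3 + c * a) * c * a - s\<^sup>2 * (s * c * a - 1)"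
    by (simp add: sa)
  moreover have "?g * b1 = t * c * b1 * c * a - s\<^sup>2 * b1"
    using ab by (simp add: left_diff_distrib mult.assoc)
  moreover have "(s ^ 3 + c * a) * c * a - s\<^sup>2 * (s * c * a - 1) = h * b1"
    unfolding hb by (simp add: algebra_simps a'_def power2_eq_square power3_eq_cube)
  ultimately have "?g * b1 = h * b1"
    by (simp only:)
  then have "?g = h"
    using nz by simp
  then show "h * s = t + c * a" and "s * h = t * c + a"
    using loc by simp_all
qed

theorem theorem4p12:
  fixes x y :: "'a::division_ring" and R :: "int \<Rightarrow> 'a"
  assumes free: "free_pair x y"
    and rec_even: "\<And>n. R (2*n) * (x * y * inverse x * inverse y) * R (2*n - 2) = 1 + R (2*n - 1)"
    and rec_odd: "\<And>n. R (2*n + 1) * (x * y * inverse x * inverse y) * R (2*n - 1) = 1 + R (2*n) ^ 4"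
    and R1: "R 1 = y * x * inverse y"
    and R2: "R 2 = y"
  shows "\<forall>n\<ge>0. nonneg_laurent x y (R n)"
proof -
  have xy: "x \<noteq> 0" "y \<noteq> 0"
    using free_pair_nonzero[OF free] by blast+
  note cancel = inverse_mult_cancel[OF xy(1)] inverse_mult_cancel[OF xy(2)]
  define c where "c = x * y * inverse x * inverse y"
  have c: "c \<noteq> 0" and inv_c: "inverse c = y * x * inverse y * inverse x"
    using xy by (simp_all add: c_def nonzero_inverse_mult_distrib mult.assoc)

  \<comment> \<open>Even-indexed and odd-indexed subsequences\<close>
  define a where "a k = R (2 * int k)" for k
  define b where "b k = R (2 * int k + 1)" for k
  have rec_a: "a (Suc k) * c * a k = 1 + b k" for k
    using rec_even[of "int k + 1"] by (simp add: a_def b_def c_def algebra_simps)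
  have rec_b: "b (Suc k) * c * b k = 1 + a (Suc k) ^ 4" for k
    using rec_odd[of "int k + 1"] by (simp add: a_def b_def c_def algebra_simps)
  have b0: "b 0 = y * x * inverse y" and a1: "a (Suc 0) = y"
    using R1 R2 by (simp_all add: a_def b_def)

  \<comment> \<open>Monomials of the conserved quantity\<close>
  define u where "u = y ^ 3 * inverse x * inverse y"
  \<comment> \<open>This is \<open>inverse y * u * y\<close>, and it is also the inverse of
    \<open>g\<close>.\<close>
  define v where "v = y ^ 2 * inverse x"
  define g where "g = x * inverse y * inverse y"
  define g' where "g' = inverse y * inverse y + x * inverse y * inverse x * inverse y
    + inverse y * inverse x * inverse y"
  \<comment> \<open>The expansion of \<open>inverse y * (a 2 * c + a 0)\<close>, with
    \<open>g\<close> and \<open>u\<close> singled out because \<open>g * u = c\<close>.\<close>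
  define h where "h = g + g' + u"
  \<comment> \<open>The inverse of \<open>c * y\<close>; it makes \<open>const\<close> hold at
    \<open>k = 0\<close>.\<close>
  define z where "z = x * inverse y * inverse x"
  have ws: "word_sum x y c" "word_sum x y u" "word_sum x y g" "word_sum x y g'"
      "word_sum x y z" "word_sum x y (b 0)"
    unfolding c_def u_def g_def g'_def z_def b0 by (intro word_sum_intros)+
  have gu: "g * u = c"
    by (simp add: g_def u_def c_def power3_eq_cube mult.assoc cancel)
  have uy: "u ^ k * y = y * v ^ k" for k
  proof (induction k)
    case (Suc k)
    have "u ^ Suc k * y = u * y * v ^ k"
      using Suc by (simp add: mult.assoc)
    also have "\<dots> = y * v ^ Suc k"
      using xy by (simp add: u_def v_def power2_eq_square power3_eq_cube mult.assoc cancel)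
    finally show ?case .
  qed simp
  have gv: "g ^ k * v ^ k = 1" for k
  proof (induction k)
    case (Suc k)
    have "g ^ Suc k * v ^ Suc k = g * (g ^ k * v ^ k) * v"
      unfolding power_Suc[of g] power_Suc2[of v] by (simp only: mult.assoc)
    also have "\<dots> = g * v"
      using Suc by simp
    also have "\<dots> = 1"
      using xy by (simp add: g_def v_def power2_eq_square mult.assoc cancel)
    finally show ?case .
  qed simp
  have const: "g ^ k * z * c * (u ^ k * y) = 1" for k
  proof -
    have "z * c * y = 1"
      using xy by (simp add: z_def c_def mult.assoc cancel)
    then have "g ^ k * (z * c * y) * v ^ k = 1"
      by (simp add: gv)
    then show ?thesis
      by (simp add: uy mult.assoc)
  qed

  \<comment> \<open>The last two clauses isolate the extreme monomials of \<open>a (Suc k)\<close>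
    and of the difference \<open>a (Suc (Suc k)) - u * a (Suc k)\<close>. The others are what
    quasi-commutation and \<open>conserved_step\<close> need to advance.\<close>
  define I where "I k \<longleftrightarrow>
      a k \<noteq> 0 \<and> a (Suc k) \<noteq> 0 \<and> b k \<noteq> 0 \<and>
      b k * a (Suc k) = a (Suc k) * c * b k \<and>
      a (Suc k) * h = a (Suc (Suc k)) * c + a k \<and>
      (\<exists>q. word_sum x y q \<and> a (Suc k) = u ^ k * y + q) \<and>
      (\<exists>q. word_sum x y q \<and> a (Suc (Suc k)) = u * a (Suc k) + (g ^ k * z + q))" for k

  have pos: "word_sum x y (a (Suc k))" "word_sum x y (b (Suc k))" if I: "I k" for k
  proof -
    have "\<exists>q. word_sum x y q \<and> a (Suc k) = u ^ k * y + q"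
      and "\<exists>r. word_sum x y r \<and> a (Suc (Suc k)) = u * a (Suc k) + (g ^ k * z + r)"
      using I by (simp_all only: I_def not_False_eq_True)
    then obtain q r where q: "word_sum x y q" "a (Suc k) = u ^ k * y + q"
      and r: "word_sum x y r" "a (Suc (Suc k)) = u * a (Suc k) + (g ^ k * z + r)"
      by (elim exE conjE)
    show wa: "word_sum x y (a (Suc k))"
      unfolding q(2) using ws q(1) by (intro word_sum_intros)
    \<comment> \<open>Only \<open>g ^ k * z\<close> is split off: against \<open>u ^ k * y\<close>
      it yields, by \<open>const\<close>, exactly the 1 to be cancelled.\<close>
    have "1 + b (Suc k) = (u * a (Suc k) + r) * c * a (Suc k) + g ^ k * z * c * a (Suc k)"
      unfolding rec_a[symmetric] r(2) by (simp add: algebra_simps)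
    moreover have "g ^ k * z * c * a (Suc k) = 1 + g ^ k * z * c * q"
      unfolding q(2) distrib_left const ..
    ultimately have "b (Suc k) = (u * a (Suc k) + r) * c * a (Suc k) + g ^ k * z * c * q"
      by simp
    then show "word_sum x y (b (Suc k))"
      using ws q(1) r(1) wa by (auto intro!: word_sum_intros)
  qed

  \<comment> \<open>Index 0 is outside the reach of \<open>pos\<close>; the even recurrence, divided
    by \<open>y * c\<close> on the left, determines \<open>a 0\<close>.\<close>
  have a0: "a 0 = inverse c * inverse y * (1 + b 0)"
  proof -
    have "y * c * a 0 = y * c * (inverse c * inverse y * (1 + b 0))"
      using rec_a[of 0] c xy by (simp add: a1 mult.assoc inverse_mult_cancel)
    then show ?thesis
      using c xy by simp
  qed
  have a0': "a 0 = y * x * inverse y * inverse x * inverse y * (1 + b 0)"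
    using a0 unfolding inv_c .
  have wa0: "word_sum x y (a 0)"
    unfolding a0' using ws by (intro word_sum_intros)
  have b1: "b (Suc 0) = (1 + y ^ 4) * inverse x"
  proof -
    have "b (Suc 0) * (c * b 0) = (1 + y ^ 4) * inverse x * (c * b 0)"
      using rec_b[of 0] xy by (simp add: a1 b0 c_def mult.assoc cancel)
    then show ?thesis
      using c xy b0 by simp
  qed
  have a2: "a (Suc (Suc 0)) = (1 + b (Suc 0)) * z"
  proof -
    have "a (Suc (Suc 0)) * (c * y) = (1 + b (Suc 0)) * z * (c * y)"
      using rec_a[of "Suc 0"] xy by (simp add: a1 z_def c_def mult.assoc cancel)
    then show ?thesis
      using c xy by simp
  qed

  \<comment> \<open>Propagation of the invariant\<close>
  have "I k" for k
  proof (induction k)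
    case 0
    have "a 0 \<noteq> 0" "b 0 \<noteq> 0"
      using one_plus_word_sum_nonzero[OF free ws(6)] c xy by (simp_all add: a0 b0)
    moreover have "b 0 * y = y * c * b 0"
      using xy by (simp add: b0 c_def mult.assoc cancel)
    moreover have "y * h = a (Suc (Suc 0)) * c + a 0"
      using xy by (simp add: a2 b1 a0' b0 h_def g_def g'_def u_def z_def c_def algebra_simps
          cancel power_numeral_reduce)
    moreover have "\<exists>q. word_sum x y q \<and> y = u ^ 0 * y + q"
      by (rule exI[of _ 0]) (simp add: word_sum_zero)
    moreover have "\<exists>q. word_sum x y q \<and> a (Suc (Suc 0)) = u * y + (g ^ 0 * z + q)"
    \<comment> \<open>The witness is read off from
      \<open>a 2 = u * y + z + inverse y * inverse x\<close>.\<close>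
    proof (intro exI conjI)
      show "word_sum x y (inverse y * inverse x)"
        by (intro word_sum_intros)
      show "a (Suc (Suc 0)) = u * y + (g ^ 0 * z + inverse y * inverse x)"
        using xy by (simp add: a2 b1 u_def z_def algebra_simps cancel power_numeral_reduce)
    qed
    ultimately show ?case
      unfolding I_def a1 using xy by (intro conjI)
  next
    case (Suc k)
    let ?a1 = "a (Suc k)" and ?a2 = "a (Suc (Suc k))" and ?a3 = "a (Suc (Suc (Suc k)))"
    let ?b0 = "b k" and ?b1 = "b (Suc k)" and ?b2 = "b (Suc (Suc k))"
    note wa = pos(1)[OF Suc] and wb = pos(2)[OF Suc]
    have "\<exists>q. word_sum x y q \<and> ?a1 = u ^ k * y + q"
      and "\<exists>r. word_sum x y r \<and> ?a2 = u * ?a1 + (g ^ k * z + r)"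
      and nz: "?a1 \<noteq> 0" "?b0 \<noteq> 0" and comm: "?b0 * ?a1 = ?a1 * c * ?b0"
      and lin: "?a1 * h = ?a2 * c + a k"
      using Suc by (simp_all only: I_def not_False_eq_True)
    then obtain q r where q: "word_sum x y q" "?a1 = u ^ k * y + q"
      and r: "word_sum x y r" "?a2 = u * ?a1 + (g ^ k * z + r)"
      by (elim exE conjE)
    \<comment> \<open>The right side of each recurrence is 1 plus a sum of words, hence nonzero, and
      so are the factors on the left.\<close>
    have "?b1 * c * ?b0 \<noteq> 0"
      unfolding rec_b using wa by (intro one_plus_word_sum_nonzero[OF free] word_sum_intros)
    then have b1nz: "?b1 \<noteq> 0"
      by auto
    have "?a2 * c * ?a1 \<noteq> 0"
      unfolding rec_a using wb by (rule one_plus_word_sum_nonzero[OF free])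
    then have a2nz: "?a2 \<noteq> 0"
      by auto
    have ab: "?a1 * ?b1 = ?b1 * c * ?a1"
      using quasi_commute_step[OF comm rec_b c nz(2)] .
    \<comment> \<open>The exponent 1 puts the even recurrence into the form
      \<open>1 + q ^ k\<close>.\<close>
    have bs: "?b1 * ?a2 = ?a2 * c * ?b1"
      using quasi_commute_step[OF ab, of _ 1] rec_a[of "Suc k"] c nz(1) by simp
    have sb: "?a2 * ?b2 = ?b2 * c * ?a2"
      using quasi_commute_step[OF bs rec_b c b1nz] .
    have lin': "h * ?a2 = ?a3 + c * ?a1" "?a2 * h = ?a3 * c + ?a1"
      using conserved_step[OF rec_a rec_a rec_a rec_b rec_b ab bs sb c nz(1) a2nz b1nz lin] .
    have new_a: "?a2 = u ^ Suc k * y + (u * q + (g ^ k * z + r))"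
      unfolding r(2) q(2) by (simp add: algebra_simps)
    have wq: "word_sum x y (u * q + (g ^ k * z + r))"
      using ws q(1) r(1) by (intro word_sum_intros)
    \<comment> \<open>In \<open>?a3 = h * ?a2 - c * ?a1\<close>, the identity
      \<open>c = g * u\<close> turns \<open>g * ?a2 - c * ?a1\<close> into
      \<open>g * (g ^ k * z + r)\<close>, which removes the subtraction.\<close>
    let ?r = "g * r + g' * ?a2"
    have new_d: "?a3 = u * ?a2 + (g ^ Suc k * z + ?r)"
    proof -
      have "?a3 = u * ?a2 + g' * ?a2 + (g * ?a2 - c * ?a1)"
        using lin'(1) by (simp add: h_def algebra_simps)
      also have "g * ?a2 - c * ?a1 = g ^ Suc k * z + g * r"
        unfolding r(2) by (simp add: algebra_simps flip: gu)
      finally show ?thesis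
        by (simp add: algebra_simps)
    qed
    have wr: "word_sum x y ?r"
      using ws r(1) wa unfolding r(2) by (intro word_sum_intros)
    show ?case
      unfolding I_def
      by (intro conjI exI) (fact nz a2nz b1nz bs lin'(2) wq new_a wr new_d)+
  qed
  then have "word_sum x y (a k)" "word_sum x y (b k)" for k
    using pos wa0 ws(6) by (cases k; blast)+
  then have "word_sum x y (R (2 * int k))" "word_sum x y (R (2 * int k + 1))" for k
    by (simp_all add: a_def b_def)
  note even_odd = this
  show ?thesis
  proof (intro allI impI)
    fix n :: int
    assume "n \<ge> 0"
    then obtain m where n: "n = int m"
      by (rule nonneg_int_cases)
    have "m = 2 * (m div 2) \<or> m = 2 * (m div 2) + 1"
      by linarith
    then have "n = 2 * int (m div 2) \<or> n = 2 * int (m div 2) + 1"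
      unfolding n by linarith
    then have "word_sum x y (R n)"
      using even_odd[of "m div 2"] by (elim disjE) (simp_all only:)
    then show "nonneg_laurent x y (R n)"
      by (rule word_sum_imp_nonneg_laurent)
  qed
qed

end
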